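(* Let $I$, $\Theta$, $A$, $\mathcal V$, $\mathcal W$, $T$ and $m_\theta$ be as in the context (including the additional conditions on $T$ and $A$ listed there). If for every $f\in\mathcal V$ the function $T(f)(\cdot)-A(\cdot,\theta)$ is decreasing on $I$ for all $\theta$ admissible for $f$, then $m$ is an impact bundle, i.e. $m$ satisfies AX.1, AX.2, AX.3 and AX.4.
   Context: Setting. $I=[0,S]$ with $S>0$, or $I=[0,\infty)$ (in which case $S=+\infty$); $\Theta\subseteq(0,\infty)$ is an interval. $A:I\times\Theta\to[0,\infty)$ is continuous, $A(\cdot,\theta)$ is injective on $I$ for each $\theta\in\Theta$, and $A(x,\cdot)$ is injective on $\Theta$ for each $x\in I$, $x>0$. $\mathcal V$ and $\mathcal W$ are sets of functions $I\to[0,\infty)$, and $T:\mathcal V\to\mathcal W$ is an operator such that $T(f)=\mathbf 0\Leftrightarrow f=\mathbf 0$, where $\mathbf 0$ is the null function. Additional conditions. (1) Every $f\in\mathcal V$ and every $T(f)$, $f\in\mathcal V$, is decreasing. (2) For all $\theta\in\Theta$ and $x\in I$: $A(x,\theta)=0\Leftrightarrow x=0$. (3) For every real $a\in I$, $a>0$, the operator $T_a$ given by $T_a(f|_{[0,a]})=T(f)|_{[0,a]}$ for $f\in\mathcal V$ is well defined (if $f=g$ on $[0,a]$ then $T(f)=T(g)$ on $[0,a]$) and strictly increasing: for $f,g\in\mathcal V$, $f\le g$ pointwise on $[0,a]$ implies $T(f)\le T(g)$ pointwise on $[0,a]$, and $f<g$ pointwise on $[0,a]$ implies $T(f)<T(g)$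 pointwise on $[0,a]$. Admissibility and the bundle $m$. For $f\in\mathcal V$, a value $\theta\in\Theta$ is admissible for $f$ if the equation $T(f)(x)=A(x,\theta)$ has a unique solution $x\in I$; this solution is denoted $m_\theta(f)$. It is assumed that each $f\in\mathcal V$ has at least one admissible $\theta$. The bundle $m$ is the family of maps $f\mapsto m_\theta(f)$. For $a\in\,]0,S[$ put $\psi_f([0,a])=\{\theta\in\Theta:\theta\text{ is admissible for }f\text{ and }m_\theta(f)\in[0,a]\}$. In statements involving both $m_\theta(f)$ and $m_\theta(g)$, $\theta$ ranges over values admissible for both $f$ and $g$. Impact bundle. $m$ is an impact bundle if for all $f,g\in\mathcal V$: AX.1: $f=\mathbf 0$ if and only if $m_\theta(f)=0$ for all $\theta$ admissible for $f$. AX.2: if $f\le g$ on $I$, then $m_\theta(f)\le m_\theta(g)$ for all admissible $\theta$. AX.3: for all $a\in\,]0,S[$: if $f(x)<g(x)$ for all $x\in[0,a]$, then $m_\theta(f)<m_\theta(g)$ for all admissible $\theta\in\psi_f([0,a])\cup\psi_g([0,a])$. AX.4: for all $a\in\,]0,S[$: if $f=g$ on $[0,a]$, then $\psi_f([0,a])=\psi_g([0,a])$ and $m_\theta(f)=m_\theta(g)$ for all $\theta$ in this set. "Increasing" and "decreasing" for functions on $I$ are meant in the non-strict sense. *)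

theory Defs
  imports "HOL-Analysis.Analysis"
begin

text \<open>
  The right end point \<open>S\<close> is an extended real, so that both admitted forms of the domain \<open>I\<close>
  are covered: the compact interval \<open>[0,S]\<close> for real \<open>S\<close>, and \<open>[0,\<infinity>)\<close> for \<open>S = \<infinity>\<close>.
\<close>

definition dom_I :: "ereal \<Rightarrow> real set" where
  "dom_I S = {x. 0 \<le> x \<and> ereal x \<le> S}"

text \<open>
  Functions on \<open>I\<close> are extensional (elements of \<open>I \<rightarrow>\<^sub>E {0..}\<close>), so HOL equality of such functions
  is equality on \<open>I\<close>, and an operator on them cannot depend on values outside \<open>I\<close>.
\<close>

definition null_fun :: "ereal \<Rightarrow> real \<Rightarrow> real" where
  "null_fun S = (\<lambda>x\<in>dom_I S. 0)"

definition admissible ::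
  "ereal \<Rightarrow> real set \<Rightarrow> (real \<Rightarrow> real \<Rightarrow> real) \<Rightarrow> ((real \<Rightarrow> real) \<Rightarrow> (real \<Rightarrow> real))
    \<Rightarrow> (real \<Rightarrow> real) \<Rightarrow> real set" where
  "admissible S \<Theta> A T f = {\<theta> \<in> \<Theta>. \<exists>!x. x \<in> dom_I S \<and> T f x = A x \<theta>}"

text \<open>Meaningful only for \<open>\<theta>\<close> admissible for \<open>f\<close>.\<close>

definition bundle_m ::
  "ereal \<Rightarrow> (real \<Rightarrow> real \<Rightarrow> real) \<Rightarrow> ((real \<Rightarrow> real) \<Rightarrow> (real \<Rightarrow> real))
    \<Rightarrow> real \<Rightarrow> (real \<Rightarrow> real) \<Rightarrow> real" where
  "bundle_m S A T \<theta> f = (THE x. x \<in> dom_I S \<and> T f x = A x \<theta>)"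

locale bundle_setting =
  fixes S :: ereal
    and \<Theta> :: "real set"
    and A :: "real \<Rightarrow> real \<Rightarrow> real"
    and V W :: "(real \<Rightarrow> real) set"
    and T :: "(real \<Rightarrow> real) \<Rightarrow> (real \<Rightarrow> real)"
  assumes S_pos: "0 < S"
    and Theta_interval: "is_interval \<Theta>"
    and Theta_pos: "\<Theta> \<subseteq> {0<..}"
    and A_nonneg: "\<And>x \<theta>. x \<in> dom_I S \<Longrightarrow> \<theta> \<in> \<Theta> \<Longrightarrow> 0 \<le> A x \<theta>"
    and A_continuous: "continuous_on (dom_I S \<times> \<Theta>) (\<lambda>(x, \<theta>). A x \<theta>)"
    and A_inj_fst: "\<And>\<theta>. \<theta> \<in> \<Theta> \<Longrightarrow> inj_on (\<lambda>x. A x \<theta>) (dom_I S)"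
    and A_inj_snd: "\<And>x. x \<in> dom_I S \<Longrightarrow> 0 < x \<Longrightarrow> inj_on (\<lambda>\<theta>. A x \<theta>) \<Theta>"
    and V_funs: "V \<subseteq> dom_I S \<rightarrow>\<^sub>E {0..}"
    and W_funs: "W \<subseteq> dom_I S \<rightarrow>\<^sub>E {0..}"
    and T_maps: "T \<in> V \<rightarrow> W"
    and T_null: "\<And>f. f \<in> V \<Longrightarrow> T f = null_fun S \<longleftrightarrow> f = null_fun S"
    and ex_admissible: "\<And>f. f \<in> V \<Longrightarrow> admissible S \<Theta> A T f \<noteq> {}"

text \<open>
  The facts \<open>T_local\<close>, \<open>T_mono\<close> and \<open>T_strict\<close> say that the restricted operators \<open>T\<^sub>a\<close>, given by
  \<open>T\<^sub>a(f|[0,a]) = T(f)|[0,a]\<close>, are well defined and strictly increasing.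
\<close>

locale bundle_setting_mono = bundle_setting +
  assumes V_decreasing: "\<And>f. f \<in> V \<Longrightarrow> antimono_on (dom_I S) f"
    and T_decreasing: "\<And>f. f \<in> V \<Longrightarrow> antimono_on (dom_I S) (T f)"
    and A_zero_iff: "\<And>x \<theta>. x \<in> dom_I S \<Longrightarrow> \<theta> \<in> \<Theta> \<Longrightarrow> A x \<theta> = 0 \<longleftrightarrow> x = 0"
    and T_local: "\<And>a f g. a \<in> dom_I S \<Longrightarrow> 0 < a \<Longrightarrow> f \<in> V \<Longrightarrow> g \<in> V \<Longrightarrow>
      (\<forall>x\<in>{0..a}. f x = g x) \<Longrightarrow> (\<forall>x\<in>{0..a}. T f x = T g x)"
    and T_mono: "\<And>a f g. a \<in> dom_I S \<Longrightarrow> 0 < a \<Longrightarrow> f \<in> V \<Longrightarrow> g \<in> V \<Longrightarrow>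
      (\<forall>x\<in>{0..a}. f x \<le> g x) \<Longrightarrow> (\<forall>x\<in>{0..a}. T f x \<le> T g x)"
    and T_strict: "\<And>a f g. a \<in> dom_I S \<Longrightarrow> 0 < a \<Longrightarrow> f \<in> V \<Longrightarrow> g \<in> V \<Longrightarrow>
      (\<forall>x\<in>{0..a}. f x < g x) \<Longrightarrow> (\<forall>x\<in>{0..a}. T f x < T g x)"

text \<open>
  In the notions below \<open>m \<theta> f\<close> stands for \<open>m\<^sub>\<theta>(f)\<close>, and \<open>D f\<close> is the set of values \<open>\<theta>\<close> admissible
  for \<open>f\<close>; \<open>psi D m f J\<close> is \<open>\<psi>\<^sub>f(J)\<close>.
\<close>

definition psi ::
  "((real \<Rightarrow> real) \<Rightarrow> real set) \<Rightarrow> (real \<Rightarrow> (real \<Rightarrow> real) \<Rightarrow> real)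
    \<Rightarrow> (real \<Rightarrow> real) \<Rightarrow> real set \<Rightarrow> real set" where
  "psi D m f J = {\<theta> \<in> D f. m \<theta> f \<in> J}"

definition AX1 ::
  "ereal \<Rightarrow> (real \<Rightarrow> real) set \<Rightarrow> ((real \<Rightarrow> real) \<Rightarrow> real set)
    \<Rightarrow> (real \<Rightarrow> (real \<Rightarrow> real) \<Rightarrow> real) \<Rightarrow> bool" where
  "AX1 S V D m \<longleftrightarrow>
    (\<forall>f\<in>V. f = null_fun S \<longleftrightarrow> (\<forall>\<theta>\<in>D f. m \<theta> f = 0))"

definition AX2 ::
  "ereal \<Rightarrow> (real \<Rightarrow> real) set \<Rightarrow> ((real \<Rightarrow> real) \<Rightarrow> real set)
    \<Rightarrow> (real \<Rightarrow> (real \<Rightarrow> real) \<Rightarrow> real) \<Rightarrow> bool" where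
  "AX2 S V D m \<longleftrightarrow>
    (\<forall>f\<in>V. \<forall>g\<in>V. (\<forall>x\<in>dom_I S. f x \<le> g x) \<longrightarrow>
      (\<forall>\<theta>\<in>D f \<inter> D g. m \<theta> f \<le> m \<theta> g))"

definition AX3 ::
  "ereal \<Rightarrow> (real \<Rightarrow> real) set \<Rightarrow> ((real \<Rightarrow> real) \<Rightarrow> real set)
    \<Rightarrow> (real \<Rightarrow> (real \<Rightarrow> real) \<Rightarrow> real) \<Rightarrow> bool" where
  "AX3 S V D m \<longleftrightarrow>
    (\<forall>f\<in>V. \<forall>g\<in>V. \<forall>a::real. 0 < a \<and> ereal a < S \<longrightarrow>
      (\<forall>x\<in>{0..a}. f x < g x) \<longrightarrow>
      (\<forall>\<theta>\<in>(psi D m f {0..a} \<union> psi D m g {0..a}) \<inter> (D f \<inter> D g). m \<theta> f < m \<theta> g))"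

definition AX4 ::
  "ereal \<Rightarrow> (real \<Rightarrow> real) set \<Rightarrow> ((real \<Rightarrow> real) \<Rightarrow> real set)
    \<Rightarrow> (real \<Rightarrow> (real \<Rightarrow> real) \<Rightarrow> real) \<Rightarrow> bool" where
  "AX4 S V D m \<longleftrightarrow>
    (\<forall>f\<in>V. \<forall>g\<in>V. \<forall>a::real. 0 < a \<and> ereal a < S \<longrightarrow>
      (\<forall>x\<in>{0..a}. f x = g x) \<longrightarrow>
      psi D m f {0..a} = psi D m g {0..a} \<and> (\<forall>\<theta>\<in>psi D m f {0..a}. m \<theta> f = m \<theta> g))"

definition impact_bundle ::
  "ereal \<Rightarrow> (real \<Rightarrow> real) set \<Rightarrow> ((real \<Rightarrow> real) \<Rightarrow> real set)
    \<Rightarrow> (real \<Rightarrow> (real \<Rightarrow> real) \<Rightarrow> real) \<Rightarrow> bool" where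
  "impact_bundle S V D m \<longleftrightarrow> AX1 S V D m \<and> AX2 S V D m \<and> AX3 S V D m \<and> AX4 S V D m"

end

theory Submission
  imports Defs
begin

text \<open>
  Since \<open>A(\<cdot>,\<theta>)\<close> is continuous, injective and nonnegative with \<open>A(0,\<theta>) = 0\<close>, it is strictly
  increasing. As \<open>T(f)\<close> is decreasing, \<open>T(f)(x) < A(x,\<theta>)\<close> at one point forces the solution
  \<open>m\<^sub>\<theta>(f)\<close> to lie strictly to the left of it, and a solution is automatically unique.
  The axioms then follow by comparing \<open>T(f)\<close> and \<open>T(g)\<close> at \<open>m\<^sub>\<theta>(f)\<close> or \<open>m\<^sub>\<theta>(g)\<close>.
\<close>

lemma dom_I_downward: "x \<in> dom_I S \<Longrightarrow> 0 \<le> y \<Longrightarrow> y \<le> x \<Longrightarrow> y \<in> dom_I S"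
  unfolding dom_I_def by (auto intro: order_trans[of "ereal y" "ereal x"])

lemma bundle_m_solves:
  assumes "\<theta> \<in> admissible S \<Theta> A T f"
  shows "bundle_m S A T \<theta> f \<in> dom_I S"
    and "T f (bundle_m S A T \<theta> f) = A (bundle_m S A T \<theta> f) \<theta>"
proof -
  have "\<exists>!x. x \<in> dom_I S \<and> T f x = A x \<theta>"
    using assms by (simp add: admissible_def)
  from theI'[OF this] show "bundle_m S A T \<theta> f \<in> dom_I S"
    "T f (bundle_m S A T \<theta> f) = A (bundle_m S A T \<theta> f) \<theta>"
    by (simp_all add: bundle_m_def)
qed

context bundle_setting_mono
begin

lemma zero_in_dom_I: "0 \<in> dom_I S"
  using S_pos by (simp add: dom_I_def zero_ereal_def[symmetric])

lemma A_strict_mono: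
  assumes "\<theta> \<in> \<Theta>" "x \<in> dom_I S" "y \<in> dom_I S" "x < y"
  shows "A x \<theta> < A y \<theta>"
proof (rule ccontr)
  assume "\<not> A x \<theta> < A y \<theta>"
  have x0: "0 \<le> x"
    using assms(2) by (simp add: dom_I_def)
  have cont: "continuous_on {0..x} (\<lambda>u. A u \<theta>)"
  proof -
    have "continuous_on {0..x} ((\<lambda>(x, \<theta>). A x \<theta>) \<circ> (\<lambda>u. (u, \<theta>)))"
      using assms(1) dom_I_downward[OF assms(2)]
      by (intro continuous_on_compose continuous_intros continuous_on_subset[OF A_continuous]) auto
    then show ?thesis
      by (simp add: o_def)
  qed
  have "A 0 \<theta> \<le> A y \<theta>"
    using A_zero_iff[OF zero_in_dom_I assms(1)] A_nonneg[OF assms(3,1)] by simp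
  \<comment> \<open>If \<open>A y \<theta>\<close> did not exceed \<open>A x \<theta>\<close>, it
    would lie between \<open>A 0 \<theta> = 0\<close> and \<open>A x \<theta>\<close>. The
    intermediate value theorem then produces it again on \<open>{0..x}\<close>, to the left of
    \<open>y\<close>, against injectivity.\<close>
  then obtain z where z: "0 \<le> z" "z \<le> x" "A z \<theta> = A y \<theta>"
    using IVT'[of "\<lambda>u. A u \<theta>" 0 "A y \<theta>" x] cont x0 \<open>\<not> A x \<theta> < A y \<theta>\<close> by auto
  then have "z = y"
    using inj_onD[OF A_inj_fst[OF assms(1)]] dom_I_downward[OF assms(2)] assms(3) by blast
  with z assms(4) show False by simp
qed

text \<open>Otherwise \<open>m\<close>, the solution, is at least \<open>x\<close>, and
  \<open>A x \<theta> \<le> A m \<theta> = T f m \<le> T f x\<close>.\<close>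

lemma bundle_m_less:
  assumes "f \<in> V" "\<theta> \<in> admissible S \<Theta> A T f" "x \<in> dom_I S" "T f x < A x \<theta>"
  shows "bundle_m S A T \<theta> f < x"
proof (rule ccontr)
  let ?m = "bundle_m S A T \<theta> f"
  assume "\<not> ?m < x"
  note m = bundle_m_solves[OF assms(2)]
  have th: "\<theta> \<in> \<Theta>"
    using assms(2) by (simp add: admissible_def)
  have "T f ?m \<le> T f x"
    using \<open>\<not> ?m < x\<close> T_decreasing[OF assms(1)] assms(3) m(1)
    by (auto simp: monotone_on_def)
  moreover have "A x \<theta> \<le> A ?m \<theta>"
    using \<open>\<not> ?m < x\<close> A_strict_mono[OF th assms(3) m(1)] by (cases "x = ?m") auto
  ultimately show False
    using m(2) assms(4) by simp
qed

text \<open>A decreasing function meets a strictly increasing one at most once.\<close>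

lemma solution_unique:
  assumes "f \<in> V" "\<theta> \<in> \<Theta>" "x \<in> dom_I S" "T f x = A x \<theta>" "y \<in> dom_I S" "T f y = A y \<theta>"
  shows "x = y"
proof -
  have False if "u < v" "u \<in> dom_I S" "v \<in> dom_I S" "T f u = A u \<theta>" "T f v = A v \<theta>" for u v
  proof -
    have "T f v \<le> T f u"
      using T_decreasing[OF assms(1)] that(1-3) by (auto simp: monotone_on_def)
    with A_strict_mono[OF assms(2) that(2,3,1)] that(4,5) show False by simp
  qed
  then show ?thesis
    using assms(3-6) by (meson linorder_neqE)
qed

text \<open>By uniqueness, admissibility reduces to the existence of a solution. This matters for
  AX.4, where admissibility for the second function has to be proved.\<close>

lemma bundle_m_eqI:
  assumes "f \<in> V" "\<theta> \<in> \<Theta>" "x \<in> dom_I S" "T f x = A x \<theta>"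
  shows "\<theta> \<in> admissible S \<Theta> A T f" and "bundle_m S A T \<theta> f = x"
proof -
  show adm: "\<theta> \<in> admissible S \<Theta> A T f"
    using assms solution_unique[OF assms(1,2)] by (auto simp: admissible_def)
  show "bundle_m S A T \<theta> f = x"
    using solution_unique[OF assms(1,2) bundle_m_solves[OF adm] assms(3,4)] .
qed

text \<open>\<open>T_mono\<close> speaks only of intervals \<open>{0..a}\<close> with
  \<open>a\<close> positive in the domain. These cover the domain, even when \<open>S\<close> is
  infinite and no single one suffices.\<close>

lemma T_le_on_dom:
  assumes "f \<in> V" "g \<in> V" "\<forall>x\<in>dom_I S. f x \<le> g x" "x \<in> dom_I S"
  shows "T f x \<le> T g x"
proof -
  obtain a where a: "a \<in> dom_I S" "0 < a" "x \<le> a"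
  proof (cases "0 < x")
    case True
    with assms(4) that show ?thesis by blast
  next
    case False
    \<comment> \<open>Here \<open>x = 0\<close>, which is not allowed as \<open>a\<close>; any
      positive real below \<open>S\<close> serves instead.\<close>
    obtain e where "0 < ereal e" "ereal e < S"
      using ereal_dense2[OF S_pos] by auto
    with False that[of e] show ?thesis
      by (simp add: dom_I_def)
  qed
  have "\<forall>u\<in>{0..a}. f u \<le> g u"
    using assms(3) dom_I_downward[OF a(1)] by auto
  moreover have "x \<in> {0..a}"
    using a(3) assms(4) by (simp add: dom_I_def)
  ultimately show ?thesis
    using T_mono[OF a(1,2) assms(1,2)] by blast
qed

lemma bundle_m_AX1: "AX1 S V (admissible S \<Theta> A T) (bundle_m S A T)"
  unfolding AX1_def
proof (intro ballI iffI)
  fix f \<theta>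
  assume f: "f \<in> V" "f = null_fun S" and th: "\<theta> \<in> admissible S \<Theta> A T f"
  note m = bundle_m_solves[OF th]
  have "T f = null_fun S"
    using T_null f by blast
  then have "A (bundle_m S A T \<theta> f) \<theta> = 0"
    using m by (simp add: null_fun_def)
  then show "bundle_m S A T \<theta> f = 0"
    using A_zero_iff[OF m(1)] th by (simp add: admissible_def)
next
  fix f
  assume f: "f \<in> V" and m0: "\<forall>\<theta>\<in>admissible S \<Theta> A T f. bundle_m S A T \<theta> f = 0"
  \<comment> \<open>The assumption on the solutions would be vacuous without an admissible value;
    one such value already gives \<open>T f 0 = A 0 \<theta> = 0\<close>.\<close>
  obtain \<theta> where th: "\<theta> \<in> admissible S \<Theta> A T f"
    using ex_admissible[OF f] by blast
  have T0: "T f 0 = 0"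
    using bundle_m_solves(2)[OF th] m0 th A_zero_iff[OF zero_in_dom_I]
    by (simp add: admissible_def)
  have ext: "T f \<in> dom_I S \<rightarrow>\<^sub>E {0..}"
    using T_maps W_funs f by blast
  \<comment> \<open>On the domain \<open>T f\<close> is squeezed between 0 and
    \<open>T f 0 = 0\<close>; off the domain both sides are \<open>undefined\<close> by
    extensionality.\<close>
  have "T f x = null_fun S x" for x
  proof (cases "x \<in> dom_I S")
    case True
    then have "T f x \<le> T f 0"
      using T_decreasing[OF f] zero_in_dom_I by (auto simp: monotone_on_def dom_I_def)
    moreover have "0 \<le> T f x"
      using PiE_mem[OF ext True] by simp
    ultimately show ?thesis
      using T0 True by (simp add: null_fun_def)
  next
    case False
    then show ?thesis
      using PiE_arb[OF ext False] by (simp add: null_fun_def)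
  qed
  then show "f = null_fun S"
    using T_null[OF f] by blast
qed

lemma bundle_m_AX2: "AX2 S V (admissible S \<Theta> A T) (bundle_m S A T)"
  unfolding AX2_def
proof (intro ballI impI)
  fix f g \<theta>
  assume fg: "f \<in> V" "g \<in> V" "\<forall>x\<in>dom_I S. f x \<le> g x"
    and th: "\<theta> \<in> admissible S \<Theta> A T f \<inter> admissible S \<Theta> A T g"
  let ?x = "bundle_m S A T \<theta> f" and ?y = "bundle_m S A T \<theta> g"
  have f: "?x \<in> dom_I S" "T f ?x = A ?x \<theta>" and g: "?y \<in> dom_I S" "T g ?y = A ?y \<theta>"
    using bundle_m_solves th by blast+
  show "?x \<le> ?y"
  \<comment> \<open>Always \<open>T f ?y \<le> T g ?y = A ?y \<theta>\<close>. In the strict case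
    \<open>?x\<close> lies to the left of \<open>?y\<close>; in case of equality \<open>?y\<close>
    also solves the equation for \<open>f\<close>.\<close>
  proof (cases "T f ?y < A ?y \<theta>")
    case True
    then show ?thesis
      using bundle_m_less[OF fg(1) _ g(1)] th by fastforce
  next
    case False
    then have "T f ?y = A ?y \<theta>"
      using T_le_on_dom[OF fg g(1)] g(2) by simp
    then show ?thesis
      using solution_unique[OF fg(1) _ f g(1)] th by (simp add: admissible_def)
  qed
qed

lemma bundle_m_AX3: "AX3 S V (admissible S \<Theta> A T) (bundle_m S A T)"
  unfolding AX3_def
proof (intro ballI allI impI)
  fix f g a \<theta>
  assume fg: "f \<in> V" "g \<in> V" and a: "0 < a \<and> ereal a < S" and less: "\<forall>x\<in>{0..a}. f x < g x"
    and th: "\<theta> \<in> (psi (admissible S \<Theta> A T) (bundle_m S A T) f {0..a} \<union>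
        psi (admissible S \<Theta> A T) (bundle_m S A T) g {0..a}) \<inter>
        (admissible S \<Theta> A T f \<inter> admissible S \<Theta> A T g)"
  let ?x = "bundle_m S A T \<theta> f" and ?y = "bundle_m S A T \<theta> g"
  have g: "?y \<in> dom_I S" "T g ?y = A ?y \<theta>"
    using bundle_m_solves th by blast+
  show "?x < ?y"
  proof (rule ccontr)
    assume nless: "\<not> ?x < ?y"
    \<comment> \<open>One of \<open>?x\<close> and \<open>?y\<close> lies in \<open>{0..a}\<close>;
      since \<open>?y \<le> ?x\<close>, the point \<open>?y\<close> does in either case, so the
      strict comparison of \<open>T f\<close> and \<open>T g\<close> is available there.\<close>
    then have "?y \<in> {0..a}"
      using th g(1) by (auto simp: psi_def dom_I_def)
    then have "T f ?y < T g ?y"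
      using T_strict[OF _ _ fg less] a by (simp add: dom_I_def less_imp_le)
    then show False
      using bundle_m_less[OF fg(1) _ g(1)] th g(2) nless by auto
  qed
qed

text \<open>The solution for \<open>f\<close> lies in \<open>{0..a}\<close>, where
  \<open>T f\<close> and \<open>T g\<close> agree, so it also solves the equation for
  \<open>g\<close>. This is one inclusion of AX.4; exchanging \<open>f\<close> and \<open>g\<close>
  gives the other.\<close>

lemma psi_local:
  assumes "f \<in> V" "g \<in> V" "0 < a" "ereal a < S" "\<forall>x\<in>{0..a}. f x = g x"
    and "\<theta> \<in> psi (admissible S \<Theta> A T) (bundle_m S A T) f {0..a}"
  shows "\<theta> \<in> psi (admissible S \<Theta> A T) (bundle_m S A T) g {0..a}"
    and "bundle_m S A T \<theta> f = bundle_m S A T \<theta> g"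
proof -
  let ?x = "bundle_m S A T \<theta> f"
  have th: "\<theta> \<in> admissible S \<Theta> A T f" "?x \<in> {0..a}"
    using assms(6) by (auto simp: psi_def)
  have "\<theta> \<in> \<Theta>"
    using th(1) by (simp add: admissible_def)
  have "T f ?x = T g ?x"
    using T_local[OF _ assms(3,1,2,5)] th(2) assms(3,4) by (simp add: dom_I_def less_imp_le)
  then have "T g ?x = A ?x \<theta>"
    using bundle_m_solves(2)[OF th(1)] by simp
  note g = bundle_m_eqI[OF assms(2) \<open>\<theta> \<in> \<Theta>\<close> bundle_m_solves(1)[OF th(1)] this]
  show "\<theta> \<in> psi (admissible S \<Theta> A T) (bundle_m S A T) g {0..a}"
    using g th(2) by (simp add: psi_def)
  show "?x = bundle_m S A T \<theta> g"
    using g(2) by simp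
qed

lemma bundle_m_AX4: "AX4 S V (admissible S \<Theta> A T) (bundle_m S A T)"
  unfolding AX4_def
proof (intro ballI allI impI)
  fix f g a
  assume fg: "f \<in> V" "g \<in> V" and a: "0 < a \<and> ereal a < S" and eq: "\<forall>x\<in>{0..a}. f x = g x"
  have eq': "\<forall>x\<in>{0..a}. g x = f x"
    using eq by simp
  note 1 = psi_local[OF fg conjunct1[OF a] conjunct2[OF a] eq]
  note 2 = psi_local[OF fg(2,1) conjunct1[OF a] conjunct2[OF a] eq']
  show "psi (admissible S \<Theta> A T) (bundle_m S A T) f {0..a} =
      psi (admissible S \<Theta> A T) (bundle_m S A T) g {0..a} \<and>
    (\<forall>\<theta>\<in>psi (admissible S \<Theta> A T) (bundle_m S A T) f {0..a}.
      bundle_m S A T \<theta> f = bundle_m S A T \<theta> g)"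
    using 1 2(1) by blast
qed

end

theorem theorem3:
  fixes S :: ereal
    and \<Theta> :: "real set"
    and A :: "real \<Rightarrow> real \<Rightarrow> real"
    and V W :: "(real \<Rightarrow> real) set"
    and T :: "(real \<Rightarrow> real) \<Rightarrow> (real \<Rightarrow> real)"
  assumes "bundle_setting_mono S \<Theta> A V W T"
    and "\<forall>f\<in>V. \<forall>\<theta>\<in>admissible S \<Theta> A T f. antimono_on (dom_I S) (\<lambda>x. T f x - A x \<theta>)"
  shows "impact_bundle S V (admissible S \<Theta> A T) (bundle_m S A T)"
proof -
  interpret bundle_setting_mono S \<Theta> A V W T by fact
  show ?thesis
    unfolding impact_bundle_def
    using bundle_m_AX1 bundle_m_AX2 bundle_m_AX3 bundle_m_AX4 by blast
qed

end
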